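(* Let $L/F$ be a finite simple field extension. Then the largest possible dimension (over $F$) of a primitive $F$-subspace of $L$ is equal to $$[L:F]-\max_{E}\,[E:F],$$ where the maximum is over all proper intermediate subfields $E$, i.e. fields $E$ with $F\subseteq E\subsetneq L$.
   Context: An $F$-subspace $B$ of $L$ is called primitive if $F(\alpha)=L$ for every $\alpha\in B\setminus\{0\}$. A finite extension $L/F$ is simple if $L=F(\theta)$ for some $\theta\in L$. In the degenerate case $L=F$ the maximum is over the empty set and is read as $0$. *)

theory Defs
  imports "HOL-Algebra.Embedded_Algebras" "HOL-Algebra.Generated_Fields"
begin

text \<open>
  The extension \<open>L/F\<close> is a HOL-Algebra field \<open>L\<close> together with a subfield \<open>F\<close> of it.
  Despite its name, the library locale \<^locale>\<open>subalgebra\<close> requires closure under addition and under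
  multiplication by scalars from \<open>F\<close> only, so \<open>subalgebra F B L\<close> says exactly that \<open>B\<close> is an
  \<open>F\<close>-subspace of \<open>L\<close>; \<open>ring.dim L F B\<close> is its dimension over \<open>F\<close>.
\<close>

definition adjoin :: "('a, 'b) ring_scheme \<Rightarrow> 'a set \<Rightarrow> 'a \<Rightarrow> 'a set" where
  "adjoin L F x = generate_field L (insert x F)"

definition simple_field_ext :: "('a, 'b) ring_scheme \<Rightarrow> 'a set \<Rightarrow> bool" where
  "simple_field_ext L F \<longleftrightarrow> (\<exists>\<theta>\<in>carrier L. adjoin L F \<theta> = carrier L)"

definition primitive_subspace :: "('a, 'b) ring_scheme \<Rightarrow> 'a set \<Rightarrow> 'a set \<Rightarrow> bool" where
  "primitive_subspace L F B \<longleftrightarrow>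
     subalgebra F B L \<and> (\<forall>x\<in>B - {\<zero>\<^bsub>L\<^esub>}. adjoin L F x = carrier L)"

definition primitive_dims :: "('a, 'b) ring_scheme \<Rightarrow> 'a set \<Rightarrow> nat set" where
  "primitive_dims L F = {ring.dim L F B |B. primitive_subspace L F B}"

definition proper_intermediate_degrees :: "('a, 'b) ring_scheme \<Rightarrow> 'a set \<Rightarrow> nat set" where
  "proper_intermediate_degrees L F = {ring.dim L F E |E. subfield E L \<and> F \<subseteq> E \<and> E \<subset> carrier L}"

text \<open>The maximum over the empty set, which occurs exactly for \<open>L = F\<close>, is read as 0.\<close>

definition max_proper_degree :: "('a, 'b) ring_scheme \<Rightarrow> 'a set \<Rightarrow> nat" where
  "max_proper_degree L F =
     (if proper_intermediate_degrees L F = {} then 0 else Max (proper_intermediate_degrees L F))"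

text \<open>
  \<^const>\<open>Max\<close> is only meaningful on finite nonempty sets; the following facts show that it is used
  on such sets here.
\<close>

lemma subspace_dim_le:
  assumes "field L" "subfield F L" "ring.finite_dimension L F (carrier L)" "subalgebra F B L"
  shows "ring.dim L F B \<le> ring.dim L F (carrier L)"
proof -
  interpret field L by fact
  have sub: "B \<subseteq> carrier L"
    using assms(4) by (rule subalgebra_in_carrier)
  have fin: "finite_dimension F B"
    using subalbegra_incl_imp_finite_dimension[OF assms(2,3,4) sub] .
  obtain Us where Us: "set Us \<subseteq> carrier L" "independent F Us" "length Us = dim F B" "Span F Us = B"
    using exists_base[OF assms(2) finite_dimensionE[OF assms(2) fin]] unfolding over_def by auto
  show ?thesis
    using independent_length_le_dimension[OF assms(2) finite_dimensionE[OF assms(2,3)] Us(2,1)] Us(3)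
    unfolding over_def by simp
qed

lemma finite_primitive_dims:
  assumes "field L" "subfield F L" "ring.finite_dimension L F (carrier L)"
  shows "finite (primitive_dims L F)"
proof (rule finite_subset)
  show "primitive_dims L F \<subseteq> {..ring.dim L F (carrier L)}"
    using subspace_dim_le[OF assms] by (auto simp: primitive_dims_def primitive_subspace_def)
qed simp

lemma primitive_dims_nonempty:
  assumes "field L" "subfield F L"
  shows "primitive_dims L F \<noteq> {}"
proof -
  interpret field L by fact
  have "subalgebra F {\<zero>\<^bsub>L\<^esub>} L"
    using Span_is_subalgebra[OF assms(2), of "[]"] by simp
  then show ?thesis
    by (auto simp: primitive_dims_def primitive_subspace_def)
qed

lemma finite_proper_intermediate_degrees:
  assumes "field L" "subfield F L" "ring.finite_dimension L F (carrier L)"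
  shows "finite (proper_intermediate_degrees L F)"
proof (rule finite_subset)
  interpret field L by fact
  have "subalgebra F E L" if "subfield E L" "F \<subseteq> E" for E
    unfolding subalgebra_def subalgebra_axioms_def
    using subring.axioms(1)[OF subfieldE(1)[OF that(1)]] subringE(6)[OF subfieldE(1)[OF that(1)]] that(2)
    by blast
  then show "proper_intermediate_degrees L F \<subseteq> {..ring.dim L F (carrier L)}"
    using subspace_dim_le[OF assms] by (auto simp: proper_intermediate_degrees_def)
qed simp

lemma proper_intermediate_degrees_empty_iff:
  assumes "subfield F L"
  shows "proper_intermediate_degrees L F = {} \<longleftrightarrow> carrier L = F"
  using assms subfieldE(3)[OF assms] by (auto simp: proper_intermediate_degrees_def)

end

theory Submission
  imports Defs "HOL-Algebra.Finite_Extensions"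
begin

text \<open>
  Write \<open>n = [L:F]\<close>, and let \<open>m\<close> be the largest degree of a proper intermediate field. A subspace
  is primitive iff it meets every proper intermediate field \<open>E\<close> in \<open>0\<close>, because a nonzero \<open>x\<close> fails
  to generate \<open>L\<close> iff it lies in some such \<open>E\<close>, for instance in \<open>F(x)\<close>. Meeting a field of degree
  \<open>m\<close> trivially forces dimension at most \<open>n - m\<close>.

  Conversely, a primitive \<open>B\<close> of dimension less than \<open>n - m\<close> can be enlarged by one dimension: if
  \<open>x\<close> lies outside \<open>B + E\<close> for all \<open>E\<close>, then \<open>B + F x\<close> still meets every \<open>E\<close> trivially
  (\<open>exists_complementary_subspace\<close>). Each \<open>B + E\<close> is a proper subspace, its dimension being at most
  \<open>dim B + m < n\<close>, but \<open>x\<close> has to avoid all of them together. There are two reasons why it can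
  (\<open>exists_outside_sums_with_intermediate_fields\<close>).

  If \<open>F\<close> is infinite, no finite union of proper subspaces is everything, and there are only finitely
  many intermediate fields: this is where simplicity enters, through Steinitz's argument. If
  \<open>L = F(\<theta>)\<close>, then \<open>E\<close> is determined by the minimal polynomial of \<open>\<theta>\<close> over \<open>E\<close>, which is one of
  the finitely many monic divisors in \<open>L[X]\<close> of the minimal polynomial of \<open>\<theta>\<close> over \<open>F\<close>.

  If \<open>F\<close> has \<open>q\<close> elements, one counts. The nonzero elements of a subfield of size \<open>s\<close> are the roots
  of \<open>X\<^sup>s\<^sup>-\<^sup>1 - 1\<close>, so distinct intermediate fields have distinct degrees. Hence the sets \<open>B + E\<close>
  together have at most \<open>q\<^sup>d (1 + q + \<dots> + q\<^sup>m) < q\<^sup>d\<^sup>+\<^sup>m\<^sup>+\<^sup>1 \<le> q\<^sup>n\<close> elements, where \<open>d = dim B\<close>.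
\<close>

section \<open>Subspaces\<close>

lemma (in ring) subalgebra_props:
  assumes "subalgebra K V R"
  shows "V \<subseteq> carrier R" and "\<zero> \<in> V"
    and "\<And>u v. \<lbrakk> u \<in> V; v \<in> V \<rbrakk> \<Longrightarrow> u \<oplus> v \<in> V"
    and "\<And>v. v \<in> V \<Longrightarrow> \<ominus> v \<in> V"
    and "\<And>k v. \<lbrakk> k \<in> K; v \<in> V \<rbrakk> \<Longrightarrow> k \<otimes> v \<in> V"
proof -
  interpret V: subalgebra K V R by fact
  show "V \<subseteq> carrier R" "\<zero> \<in> V" using V.subset V.one_closed by auto
  show "u \<oplus> v \<in> V" if "u \<in> V" "v \<in> V" for u v using V.m_closed[OF that] by simp
  show "\<ominus> v \<in> V" if "v \<in> V" for v using V.m_inv_closed[OF that] by (simp add: a_inv_def)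
  show "k \<otimes> v \<in> V" if "k \<in> K" "v \<in> V" for k v using V.smult_closed[OF that] .
qed

lemma (in ring) subalgebra_smult_cancel:
  assumes "subfield K R" "subalgebra K V R" "k \<in> K - {\<zero>}" "x \<in> carrier R" "k \<otimes> x \<in> V"
  shows "x \<in> V"
proof -
  have "inv k \<in> K" "inv k \<otimes> k = \<one>" and k: "k \<in> carrier R"
    using subfield_m_inv[OF assms(1,3)] subfieldE(3)[OF assms(1)] assms(3) by auto
  then have "x = inv k \<otimes> (k \<otimes> x)"
    using subfieldE(3)[OF assms(1)] assms(4) m_assoc[of "inv k" k x] by auto
  then show ?thesis
    using subalgebra_props(5)[OF assms(2) \<open>inv k \<in> K\<close> assms(5)] by simp
qed

lemma (in ring) intermediate_ring_is_subalgebra: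
  assumes "subring E R" "K \<subseteq> E"
  shows "subalgebra K E R"
  unfolding subalgebra_def subalgebra_axioms_def
  using subring.axioms(1)[OF assms(1)] subringE(6)[OF assms(1)] assms(2) by blast

lemma (in ring) subalgebra_add_incl:
  assumes "subalgebra K B R" "subalgebra K E R"
  shows "B \<subseteq> B <+>\<^bsub>R\<^esub> E" "E \<subseteq> B <+>\<^bsub>R\<^esub> E"
proof -
  note B = subalgebra_props[OF assms(1)] and E = subalgebra_props[OF assms(2)]
  have "b \<oplus> \<zero> = b" if "b \<in> B" for b using that B(1) by auto
  then show "B \<subseteq> B <+>\<^bsub>R\<^esub> E" using E(2) unfolding set_add_def' by force
  have "\<zero> \<oplus> e = e" if "e \<in> E" for e using that E(1) by auto
  then show "E \<subseteq> B <+>\<^bsub>R\<^esub> E" using B(2) unfolding set_add_def' by force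
qed

lemma (in ring) subalgebra_eq_if_dim_eq:
  assumes K: "subfield K R" and fin: "finite_dimension K E" and V: "subalgebra K V R"
    and sub: "V \<subseteq> E" and le: "dim K E \<le> dim K V"
  shows "V = E"
proof -
  have finV: "finite_dimension K V"
    using subalbegra_incl_imp_finite_dimension[OF K fin V sub] .
  obtain Us where Us: "set Us \<subseteq> carrier R" "independent K Us" "length Us = dim K V" "Span K Us = V"
    using exists_base[OF K finite_dimensionE[OF K finV]] unfolding over_def by auto
  have "set Us \<subseteq> E" using Span_base_incl[OF K Us(1)] Us(4) sub by auto
  moreover have "length Us = dim K E"
    using independent_length_le_dimension[OF K finite_dimensionE[OF K fin] Us(2) \<open>set Us \<subseteq> E\<close>]
      le Us(3) unfolding over_def by simp
  ultimately show ?thesis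
    using independent_length_eq_dimension[OF K finite_dimensionE[OF K fin] Us(2)] Us(4)
    unfolding over_def by auto
qed

lemma (in ring) card_dimension:
  assumes K: "subfield K R" "finite K" and "dimension n K E"
  shows "card E = card K ^ n"
proof -
  obtain Us where Us: "set Us \<subseteq> carrier R" "independent K Us" "length Us = n" "Span K Us = E"
    using exists_base[OF K(1) assms(3)] by auto
  let ?coords = "{Ks. set Ks \<subseteq> K \<and> length Ks = n}"
  have "E = (\<lambda>Ks. combine Ks Us) ` ?coords"
    using Span_eq_combine_set_length_version[OF K(1) Us(1)] Us(3,4) by auto
  moreover have "inj_on (\<lambda>Ks. combine Ks Us) ?coords"
  proof (rule inj_onI)
    fix Ks Ks' assume *: "Ks \<in> ?coords" "Ks' \<in> ?coords" "combine Ks Us = combine Ks' Us"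
    then have "combine Ks Us \<in> Span K Us"
      using Span_eq_combine_set_length_version[OF K(1) Us(1)] Us(3) by auto
    from unique_decomposition[OF K(1) Us(2) this] show "Ks = Ks'"
      using * Us(3) by auto
  qed
  ultimately show ?thesis
    using card_lists_length_eq[OF K(2), of n] by (simp add: card_image)
qed

text \<open>
  Put \<open>x\<close> outside all members of a finite family, and \<open>y\<close> outside one further subspace \<open>V\<close>
  containing \<open>x\<close>. The affine line \<open>{y + c x}\<close> misses \<open>V\<close> and meets every other member at most once,
  since two common points would put \<open>x\<close> into it; an infinite field leaves a point on the line.
\<close>

lemma (in ring) finite_union_of_proper_subspaces:
  assumes K: "subfield K R" "infinite K"
    and "finite \<V>" and "\<And>V. V \<in> \<V> \<Longrightarrow> subalgebra K V R \<and> V \<subset> carrier R"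
  shows "\<exists>x\<in>carrier R. x \<notin> \<Union>\<V>"
  using assms(3,4)
proof (induction \<V> rule: finite_induct)
  case empty
  then show ?case by auto
next
  case (insert V \<V>)
  then obtain x where x: "x \<in> carrier R" "x \<notin> \<Union>\<V>" by auto
  show ?case
  proof (cases "x \<in> V")
    case False
    then show ?thesis using x by auto
  next
    case True
    have subV: "subalgebra K V R" using insert.prems by auto
    obtain y where y: "y \<in> carrier R" "y \<notin> V" using insert.prems[of V] by auto
    have Kc: "K \<subseteq> carrier R" using subfieldE(3)[OF K(1)] .
    \<comment> \<open>the parameters \<open>c\<close> at which the line \<open>{y + c x}\<close> meets \<open>W\<close>\<close>
    define hits where "hits W = {c \<in> K. y \<oplus> c \<otimes> x \<in> W}" for W
    have "finite (hits W)" if "W \<in> \<V>" for W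
    proof -
      have W: "subalgebra K W R" using insert.prems that by auto
      have "c = c'" if c: "c \<in> hits W" "c' \<in> hits W" for c c'
      proof (rule ccontr)
        assume "c \<noteq> c'"
        have cc: "c \<in> K" "c' \<in> K" "c \<in> carrier R" "c' \<in> carrier R"
          and mem: "y \<oplus> c \<otimes> x \<in> W" "y \<oplus> c' \<otimes> x \<in> W"
          using c Kc by (auto simp: hits_def)
        have "(y \<oplus> c \<otimes> x) \<oplus> \<ominus> (y \<oplus> c' \<otimes> x) = (c \<oplus> \<ominus> c') \<otimes> x"
          using cc x(1) y(1) by algebra
        then have "(c \<oplus> \<ominus> c') \<otimes> x \<in> W"
          using subalgebra_props(3)[OF W mem(1) subalgebra_props(4)[OF W mem(2)]] by simp
        moreover have "c \<oplus> \<ominus> c' \<in> K - {\<zero>}"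
          using subringE(5,7)[OF subfieldE(1)[OF K(1)]] cc \<open>c \<noteq> c'\<close>
          by (metis DiffI minus_equality minus_minus singletonD a_inv_closed)
        ultimately have "x \<in> W"
          using subalgebra_smult_cancel[OF K(1) W _ x(1)] by blast
        then show False using x(2) \<open>W \<in> \<V>\<close> by auto
      qed
      then have "hits W \<subseteq> {c}" if "c \<in> hits W" for c using that by auto
      then show ?thesis by (metis finite.emptyI finite.insertI finite_subset ex_in_conv)
    qed
    then have "finite (\<Union>W\<in>\<V>. hits W)" using insert.hyps by auto
    then obtain c where c: "c \<in> K" "c \<notin> (\<Union>W\<in>\<V>. hits W)"
      using K(2) by (meson finite_subset subsetI)
    have cR: "c \<in> carrier R" using c Kc by auto
    have "y \<oplus> c \<otimes> x \<notin> V"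
    proof
      assume "y \<oplus> c \<otimes> x \<in> V"
      moreover have "\<ominus> (c \<otimes> x) \<in> V"
        using subalgebra_props(4,5)[OF subV] c(1) True by auto
      ultimately have "(y \<oplus> c \<otimes> x) \<oplus> \<ominus> (c \<otimes> x) \<in> V"
        using subalgebra_props(3)[OF subV] by blast
      moreover have "(y \<oplus> c \<otimes> x) \<oplus> \<ominus> (c \<otimes> x) = y"
        using cR x(1) y(1) by algebra
      ultimately show False using y(2) by simp
    qed
    moreover have "y \<oplus> c \<otimes> x \<notin> \<Union>\<V>" using c by (auto simp: hits_def)
    ultimately show ?thesis using x(1) y(1) cR by (intro bexI[of _ "y \<oplus> c \<otimes> x"]) auto
  qed
qed

text \<open>
  If \<open>k x + b\<close> with \<open>k \<noteq> 0\<close> lay in \<open>E\<close>, then \<open>x\<close> would lie in \<open>B + E\<close>. So a point outside all sums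
  \<open>B + E\<close> can be adjoined to \<open>B\<close> without creating an intersection with any \<open>E\<close>.
\<close>

lemma (in ring) exists_complementary_subspace:
  assumes K: "subfield K R"
    and \<E>: "\<And>E. E \<in> \<E> \<Longrightarrow> finite_dimension K E"
    and outside: "\<And>B d. \<lbrakk> dimension d K B; d < c \<rbrakk> \<Longrightarrow>
      \<exists>x\<in>carrier R. x \<notin> B \<and> (\<forall>E\<in>\<E>. x \<notin> B <+>\<^bsub>R\<^esub> E)"
  shows "d \<le> c \<Longrightarrow> \<exists>B. dimension d K B \<and> (\<forall>E\<in>\<E>. B \<inter> E \<subseteq> {\<zero>})"
proof (induction d)
  case 0
  show ?case by (intro exI[of _ "{\<zero>}"]) auto
next
  case (Suc d)
  then obtain B where B: "dimension d K B" "\<And>E. E \<in> \<E> \<Longrightarrow> B \<inter> E \<subseteq> {\<zero>}" by auto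
  obtain x where x: "x \<in> carrier R" "x \<notin> B" "\<And>E. E \<in> \<E> \<Longrightarrow> x \<notin> B <+>\<^bsub>R\<^esub> E"
    using outside[OF B(1)] Suc.prems by auto
  have subB: "subalgebra K B R"
    using finite_dimension_imp_subalgebra[OF K finite_dimensionI[OF B(1)]] .
  have "dimension (Suc d) K (line_extension K x B)"
    using Suc_dim[OF x(1,2) B(1)] .
  moreover have "y = \<zero>" if E: "E \<in> \<E>" and y: "y \<in> line_extension K x B" "y \<in> E" for E y
  proof -
    obtain k b where kb: "k \<in> K" "b \<in> B" "y = k \<otimes> x \<oplus> b"
      using y(1) line_extension_mem_iff by auto
    have subE: "subalgebra K E R" and sum: "subalgebra K (B <+>\<^bsub>R\<^esub> E) R"
      using finite_dimension_imp_subalgebra[OF K] \<E>[OF E]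
        sum_space_dim(1)[OF K finite_dimensionI[OF B(1)]] by auto
    have in_carrier: "k \<in> carrier R" "b \<in> carrier R"
      using kb subfieldE(3)[OF K] subalgebra_props(1)[OF subB] by auto
    have "k = \<zero>"
    proof (rule ccontr)
      assume "k \<noteq> \<zero>"
      have "k \<otimes> x = y \<oplus> \<ominus> b"
        using kb(3) in_carrier x(1) by algebra
      moreover have "y \<in> B <+>\<^bsub>R\<^esub> E" "\<ominus> b \<in> B <+>\<^bsub>R\<^esub> E"
        using subalgebra_add_incl[OF subB subE] y(2) subalgebra_props(4)[OF subB kb(2)] by auto
      ultimately have "k \<otimes> x \<in> B <+>\<^bsub>R\<^esub> E"
        using subalgebra_props(3)[OF sum] by simp
      then show False
        using subalgebra_smult_cancel[OF K sum _ x(1)] kb(1) \<open>k \<noteq> \<zero>\<close> x(3)[OF E] by auto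
    qed
    then have "y = b" using kb(3) in_carrier x(1) by simp
    then show ?thesis using B(2)[OF E] kb(2) y(2) by auto
  qed
  ultimately show ?case by blast
qed

section \<open>Finitely many intermediate fields of a simple extension\<close>

lemma finite_submultisets: "finite {M. M \<subseteq># N}"
proof (rule finite_subset)
  show "{M. M \<subseteq># N} \<subseteq> mset ` {xs. set xs \<subseteq> set_mset N \<and> length xs \<le> size N}"
  proof
    fix M assume "M \<in> {M. M \<subseteq># N}"
    moreover obtain xs where "mset xs = M" using ex_mset by auto
    ultimately show "M \<in> mset ` {xs. set xs \<subseteq> set_mset N \<and> length xs \<le> size N}"
      using set_mset_mono[of M N] size_mset_mono[of M N] by force
  qed
  show "finite (mset ` {xs. set xs \<subseteq> set_mset N \<and> length xs \<le> size N})"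
    by (intro finite_imageI finite_lists_length_le) auto
qed

text \<open>
  Up to associates, an element is its multiset of prime factors, and for a divisor of \<open>b\<close> this is
  a submultiset of the prime factors of \<open>b\<close>.
\<close>

lemma (in factorial_monoid) finite_divisors_up_to_associates:
  assumes b: "b \<in> carrier G"
    and D: "D \<subseteq> carrier G" "\<And>a. a \<in> D \<Longrightarrow> a divides b"
    and inj: "\<And>a a'. \<lbrakk> a \<in> D; a' \<in> D; a \<sim> a' \<rbrakk> \<Longrightarrow> a = a'"
  shows "finite D"
proof -
  have "\<forall>a\<in>carrier G. \<exists>as. set as \<subseteq> carrier G \<and> wfactors G as a"
    using wfactors_exist by blast
  then obtain fac where fac: "\<And>a. a \<in> carrier G \<Longrightarrow> set (fac a) \<subseteq> carrier G"
    "\<And>a. a \<in> carrier G \<Longrightarrow> wfactors G (fac a) a"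
    by metis
  have iff: "a divides a' \<longleftrightarrow> fmset G (fac a) \<subseteq># fmset G (fac a')"
    if "a \<in> carrier G" "a' \<in> carrier G" for a a'
    using divides_as_fmsubset fac that by blast
  show ?thesis
  proof (rule finite_imageD)
    have "(\<lambda>a. fmset G (fac a)) ` D \<subseteq> {M. M \<subseteq># fmset G (fac b)}"
      using D iff b by auto
    then show "finite ((\<lambda>a. fmset G (fac a)) ` D)"
      using finite_submultisets finite_subset by blast
    show "inj_on (\<lambda>a. fmset G (fac a)) D"
    proof (rule inj_onI)
      fix a a' assume *: "a \<in> D" "a' \<in> D" "fmset G (fac a) = fmset G (fac a')"
      then have "a \<sim> a'"
        using iff[of a a'] iff[of a' a] D(1) unfolding associated_def by (auto simp: subsetD)
      then show "a = a'" using inj * by auto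
    qed
  qed
qed

lemma (in domain) monic_associated_eq:
  assumes K: "subfield K R" and p: "p \<in> carrier (K[X])" "lead_coeff p = \<one>" "p \<noteq> []"
    and q: "q \<in> carrier (K[X])" "lead_coeff q = \<one>" "p \<sim>\<^bsub>K[X]\<^esub> q"
  shows "p = q"
proof -
  interpret UP: principal_domain "K[X]"
    using univ_poly_is_principal[OF K] .
  have same: "PIdl\<^bsub>K[X]\<^esub> p = PIdl\<^bsub>K[X]\<^esub> q"
    using UP.associated_iff_same_ideal[OF p(1) q(1)] q(3) by simp
  have "PIdl\<^bsub>K[X]\<^esub> p \<noteq> {[]}"
    using UP.cgenideal_self[OF p(1)] p(3) by auto
  from exists_unique_gen[OF K UP.cgenideal_ideal[OF p(1)] this] show ?thesis
    using p(1,2) q(1,2) same by auto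
qed

lemma (in domain) finite_monic_divisors:
  assumes K: "subfield K R" and f: "f \<in> carrier (K[X])" "f \<noteq> []"
  shows "finite {p \<in> carrier (K[X]). p \<noteq> [] \<and> lead_coeff p = \<one> \<and> p divides\<^bsub>K[X]\<^esub> f}"
proof -
  interpret UP: principal_domain "K[X]"
    using univ_poly_is_principal[OF K] .
  show ?thesis
  proof (rule UP.mult_of.finite_divisors_up_to_associates[of f], goal_cases)
    case 1
    then show ?case using f by (simp add: univ_poly_zero)
  next
    case 2
    then show ?case by (auto simp: univ_poly_zero)
  next
    case (3 p)
    then show ?case using UP.divides_imp_divides_mult f by (simp add: univ_poly_zero)
  next
    case (4 p q)
    then show ?case
      using monic_associated_eq[OF K, of p q] UP.assoc_iff_assoc_mult[of p q] by auto
  qed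
qed

lemma (in field) subfield_inter:
  assumes "subfield K R" "subfield K' R"
  shows "subfield (K \<inter> K') R"
  using subring_inter[OF assms[THEN subfieldE(1)]] assms[THEN subfield_m_inv(1)]
  by (intro subfieldI') auto

text \<open>
  \<open>E\<close> and \<open>E'\<close> share their minimal polynomial \<open>p\<close> of \<open>\<theta>\<close>, so \<open>p\<close> has coefficients in
  \<open>D = E \<inter> E'\<close>, and \<open>[L:D] \<le> deg p = [L:E]\<close> leaves no room between \<open>D\<close> and \<open>E\<close>.
\<close>

lemma (in field) intermediate_field_subset_if_Irr_eq:
  assumes F: "subfield F R" and fin: "finite_dimension F (carrier R)"
    and \<theta>: "\<theta> \<in> carrier R" "generate_field R (insert \<theta> F) = carrier R"
    and E: "subfield E R" "F \<subseteq> E" and E': "subfield E' R" "F \<subseteq> E'"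
    and eq: "Irr E \<theta> = Irr E' \<theta>"
  shows "E \<subseteq> E'"
proof -
  have algF: "(algebraic over F) \<theta>"
    using finite_dimension_imp_algebraic[OF F carrier_is_subring fin \<theta>(1)] .
  have alg: "(algebraic over M) \<theta>" if "F \<subseteq> M" for M
    using algebraic_mono[OF that algF] .
  have dim_L: "dimension (degree (Irr M \<theta>)) M (carrier R)" if M: "subfield M R" "F \<subseteq> M" for M
  proof -
    have "subfield (simple_extension M \<theta>) R"
      using simple_extension_is_subfield[OF M(1) \<theta>(1)] alg[OF M(2)] by simp
    moreover have "insert \<theta> F \<subseteq> simple_extension M \<theta>"
      using simple_extension_mem[OF subfieldE(1)[OF M(1)] \<theta>(1)]
        simple_extension_incl[OF subfieldE(3)[OF M(1)] \<theta>(1)] M(2) by auto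
    moreover have "insert \<theta> F \<subseteq> carrier R"
      using subfieldE(3)[OF F] \<theta>(1) by auto
    ultimately have "carrier R \<subseteq> simple_extension M \<theta>"
      using generate_field_min_subfield1 \<theta>(2) by metis
    then have "simple_extension M \<theta> = carrier R"
      using simple_extension_in_carrier[OF subfieldE(3)[OF M(1)] \<theta>(1)] by auto
    then show ?thesis
      using dimension_simple_extension[OF M(1) \<theta>(1) alg[OF M(2)]] by simp
  qed
  have tower: "dim F (carrier R) = dim F M * degree (Irr M \<theta>)" "finite_dimension F M"
    if M: "subfield M R" "F \<subseteq> M" for M
  proof -
    show finM: "finite_dimension F M"
      using subalbegra_incl_imp_finite_dimension[OF F fin
          intermediate_ring_is_subalgebra[OF subfieldE(1)[OF M(1)] M(2)] subfieldE(3)[OF M(1)]] .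
    show "dim F (carrier R) = dim F M * degree (Irr M \<theta>)"
      using telescopic_base_dim(2)[OF F M(1) finM finite_dimensionI[OF dim_L[OF M]]]
        dimI[OF M(1) dim_L[OF M]] unfolding over_def by simp
  qed
  define D where "D = E \<inter> E'"
  have D: "subfield D R" "F \<subseteq> D"
    using subfield_inter[OF E(1) E'(1)] E(2) E'(2) by (auto simp: D_def)
  note IrrE_E = IrrE[OF E(1) \<theta>(1) alg[OF E(2)]] and IrrE_E' = IrrE[OF E'(1) \<theta>(1) alg[OF E'(2)]]
  have "Irr E \<theta> \<in> carrier (D[X])"
    using IrrE_E(1) IrrE_E'(1) eq
    unfolding D_def univ_poly_carrier[symmetric] polynomial_def by auto
  moreover have "Irr E \<theta> \<noteq> []"
    using pirreducibleE(1)[OF subfieldE(1)[OF E(1)] IrrE_E(1,2)] .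
  ultimately have "degree (Irr D \<theta>) \<le> degree (Irr E \<theta>)"
    using pdivides_imp_degree_le[OF subfieldE(1)[OF D(1)] IrrE(1)[OF D(1) \<theta>(1) alg[OF D(2)]]]
      Irr_minimal[OF D(1) \<theta>(1) alg[OF D(2)]] IrrE_E(4) by blast
  then have "dim F E * degree (Irr E \<theta>) \<le> dim F D * degree (Irr E \<theta>)"
    using tower(1)[OF E] tower(1)[OF D] by (metis mult_le_mono2)
  moreover have "0 < degree (Irr E \<theta>)"
    using pirreducible_degree[OF E(1) IrrE_E(1,2)] by simp
  ultimately have "dim F E \<le> dim F D" by simp
  then have "D = E"
    using subalgebra_eq_if_dim_eq[OF F tower(2)[OF E]
        intermediate_ring_is_subalgebra[OF subfieldE(1)[OF D(1)] D(2)]] by (auto simp: D_def)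
  then show ?thesis by (auto simp: D_def)
qed

lemma (in field) finite_intermediate_fields:
  assumes F: "subfield F R" and fin: "finite_dimension F (carrier R)"
    and \<theta>: "\<theta> \<in> carrier R" "generate_field R (insert \<theta> F) = carrier R"
  shows "finite {E. subfield E R \<and> F \<subseteq> E}"
proof (rule finite_imageD)
  have algF: "(algebraic over F) \<theta>"
    using finite_dimension_imp_algebraic[OF F carrier_is_subring fin \<theta>(1)] .
  note IrrF = IrrE[OF F \<theta>(1) algF]
  show "inj_on (\<lambda>E. Irr E \<theta>) {E. subfield E R \<and> F \<subseteq> E}"
    using intermediate_field_subset_if_Irr_eq[OF F fin \<theta>]
    by (intro inj_onI equalityI) (simp_all add: conj_commute)
  let ?f = "Irr F \<theta>" and ?LX = "poly_ring R"
  have f: "?f \<in> carrier ?LX" "?f \<noteq> []"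
    using carrier_polynomial_shell[OF subfieldE(1)[OF F] IrrF(1)]
      pirreducibleE(1)[OF subfieldE(1)[OF F] IrrF(1,2)] by auto
  have "(\<lambda>E. Irr E \<theta>) ` {E. subfield E R \<and> F \<subseteq> E}
      \<subseteq> {p \<in> carrier ?LX. p \<noteq> [] \<and> lead_coeff p = \<one> \<and> p divides\<^bsub>?LX\<^esub> ?f}"
  proof clarify
    fix E assume E: "subfield E R" "F \<subseteq> E"
    have alg: "(algebraic over E) \<theta>" using algebraic_mono[OF E(2) algF] .
    note IrrE_E = IrrE[OF E(1) \<theta>(1) alg]
    have "?f \<in> carrier (E[X])"
      using IrrF(1) E(2) unfolding univ_poly_carrier[symmetric] polynomial_def by auto
    then have "Irr E \<theta> pdivides ?f"
      using Irr_minimal[OF E(1) \<theta>(1) alg] IrrF(4) by blast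
    then show "Irr E \<theta> \<in> carrier ?LX \<and> Irr E \<theta> \<noteq> [] \<and> lead_coeff (Irr E \<theta>) = \<one> \<and>
        Irr E \<theta> divides\<^bsub>?LX\<^esub> ?f"
      using carrier_polynomial_shell[OF subfieldE(1)[OF E(1)] IrrE_E(1)] IrrE_E(3)
        pirreducibleE(1)[OF subfieldE(1)[OF E(1)] IrrE_E(1,2)]
      unfolding pdivides_def by auto
  qed
  then show "finite ((\<lambda>E. Irr E \<theta>) ` {E. subfield E R \<and> F \<subseteq> E})"
    using finite_monic_divisors[OF carrier_is_subfield f] finite_subset by blast
qed

section \<open>Avoiding all intermediate fields at once\<close>

text \<open>
  The nonzero elements of a subfield with \<open>s\<close> elements satisfy \<open>x\<^sup>s\<^sup>-\<^sup>1 = 1\<close>, an equation with at most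
  \<open>s - 1\<close> solutions; so they are exactly its solutions.
\<close>

lemma (in field) finite_subfield_eq_if_card_eq:
  assumes fin: "finite (carrier R)" and E: "subfield E R" "subfield E' R" and card: "card E = card E'"
  shows "E = E'"
proof -
  \<comment> \<open>equality holds because both sides have \<open>card E - 1\<close> elements\<close>
  have roots: "E - {\<zero>} = {x \<in> carrier R. x [^] (card E - 1) = \<one>}" if E: "subfield E R" for E
  proof -
    have EC: "E \<subseteq> carrier R" and "finite E" "\<zero> \<in> E" "\<one> \<in> E"
      using subfieldE(3)[OF E] finite_subset[OF _ fin] subringE(2,3)[OF subfieldE(1)[OF E]] by auto
    interpret E: field "R \<lparr> carrier := E \<rparr>" using subfield_iff(2)[OF E] .
    have c: "card (E - {\<zero>}) = card E - 1" using \<open>\<zero> \<in> E\<close> \<open>finite E\<close> by simp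
    have pos: "card E - 1 \<noteq> 0"
      using c \<open>\<one> \<in> E\<close> \<open>finite E\<close> one_not_zero by (metis DiffI card_0_eq empty_iff finite_Diff singletonD)
    have "x [^] (card E - 1) = \<one>" if x: "x \<in> E - {\<zero>}" for x
    proof -
      interpret units: group "Multiplicative_Group.mult_of (R \<lparr> carrier := E \<rparr>)" using E.field_mult_group .
      have "x [^]\<^bsub>Multiplicative_Group.mult_of (R \<lparr> carrier := E \<rparr>)\<^esub> order (Multiplicative_Group.mult_of (R \<lparr> carrier := E \<rparr>)) = \<one>"
        using units.pow_order_eq_1[of x] x by simp
      then show ?thesis
        using c by (simp add: order_def Multiplicative_Group.nat_pow_mult_of nat_pow_def)
    qed
    then have sub: "E - {\<zero>} \<subseteq> {x \<in> carrier R. x [^] (card E - 1) = \<one>}"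
      using EC by auto
    show ?thesis
      using card_subset_eq[OF _ sub] card_mono[OF _ sub] num_roots_le_deg[OF fin pos] c fin by auto
  qed
  have "\<zero> \<in> E" "\<zero> \<in> E'"
    using subringE(2)[OF subfieldE(1)] E by auto
  moreover have "E - {\<zero>} = E' - {\<zero>}"
    using roots[OF E(1)] roots[OF E(2)] card by simp
  ultimately show ?thesis by auto
qed

lemma sum_powers_less:
  fixes q :: nat
  assumes "2 \<le> q"
  shows "(\<Sum>j\<le>m. q ^ j) < q ^ Suc m"
proof (induction m)
  case 0
  then show ?case using assms by simp
next
  case (Suc m)
  have "(\<Sum>j\<le>Suc m. q ^ j) < 2 * q ^ Suc m" using Suc by simp
  also have "\<dots> \<le> q ^ Suc (Suc m)" using assms mult_le_mono1[of 2 q "q ^ Suc m"] by simp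
  finally show ?case .
qed

text \<open>
  All \<open>B + E\<close> have dimension at most \<open>d + m < [L:F]\<close>. Over an infinite \<open>F\<close>, properness of these
  finitely many subspaces is enough. Over a finite \<open>F\<close> it is not, and the count needs that the
  degrees of the \<open>E\<close> are distinct: this turns the total size into a geometric sum.
\<close>

lemma (in field) exists_outside_sums_with_intermediate_fields:
  assumes F: "subfield F R" and fin: "finite_dimension F (carrier R)"
    and \<theta>: "\<theta> \<in> carrier R" "generate_field R (insert \<theta> F) = carrier R"
    and \<E>: "\<And>E. E \<in> \<E> \<Longrightarrow> subfield E R \<and> F \<subseteq> E \<and> dim F E \<le> m"
    and B: "dimension d F B" and small: "d + m < dim F (carrier R)"
  shows "\<exists>x\<in>carrier R. x \<notin> B \<and> (\<forall>E\<in>\<E>. x \<notin> B <+>\<^bsub>R\<^esub> E)"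
proof -
  have finB: "finite_dimension F B" using finite_dimensionI[OF B] .
  have subB: "subalgebra F B R" using finite_dimension_imp_subalgebra[OF F finB] .
  have dimB: "dim F B = d" using dimI[OF F B] unfolding over_def .
  have subE: "subalgebra F E R" and finE: "finite_dimension F E" if "E \<in> \<E>" for E
  proof -
    show "subalgebra F E R"
      using intermediate_ring_is_subalgebra[OF subfieldE(1)] \<E>[OF that] by auto
    then show "finite_dimension F E"
      using subalbegra_incl_imp_finite_dimension[OF F fin] subalgebra_props(1) by blast
  qed
  have sum: "subalgebra F (B <+>\<^bsub>R\<^esub> E) R" "dim F (B <+>\<^bsub>R\<^esub> E) \<le> d + m" if "E \<in> \<E>" for E
    using finite_dimension_imp_subalgebra[OF F sum_space_dim(1)[OF F finB finE[OF that]]]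
      sum_space_dim(2)[OF F finB finE[OF that]] dimB \<E>[OF that] unfolding over_def by auto
  have finite_\<E>: "finite \<E>"
    using finite_subset[OF _ finite_intermediate_fields[OF F fin \<theta>]] \<E> by blast
  show ?thesis
  proof (cases "finite F")
    case False
    have "\<exists>x\<in>carrier R. x \<notin> \<Union>(insert B ((\<lambda>E. B <+>\<^bsub>R\<^esub> E) ` \<E>))"
    proof (rule finite_union_of_proper_subspaces[OF F False])
      show "finite (insert B ((\<lambda>E. B <+>\<^bsub>R\<^esub> E) ` \<E>))" using finite_\<E> by simp
      fix V assume V: "V \<in> insert B ((\<lambda>E. B <+>\<^bsub>R\<^esub> E) ` \<E>)"
      then have subV: "subalgebra F V R" and "dim F V \<le> d + m"
        using subB sum dimB by auto
      then have "V \<noteq> carrier R" using small by auto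
      then show "subalgebra F V R \<and> V \<subset> carrier R"
        using subV subalgebra_props(1)[OF subV] by auto
    qed
    then show ?thesis by auto
  next
    case True
    let ?q = "card F"
    have card: "card V = ?q ^ dim F V" if "finite_dimension F V" for V
      using card_dimension[OF F True finite_dimensionE[OF F that]] unfolding over_def .
    have "card {\<zero>, \<one>} \<le> ?q"
      using subringE(2,3)[OF subfieldE(1)[OF F]] by (intro card_mono True) auto
    then have q: "2 \<le> ?q" by simp
    have finL: "finite (carrier R)"
      using card[OF fin] q card.infinite by fastforce
    have card_L: "card (carrier R) = ?q ^ dim F (carrier R)" using card[OF fin] .
    show ?thesis
    proof (cases "\<E> = {}")
      case True
      \<comment> \<open>This happens for \<open>L = F\<close>. The count of the sums \<open>B + E\<close> then says nothing about \<open>B\<close>.\<close>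
      have "B \<noteq> carrier R" using dimB small by auto
      then show ?thesis using True subalgebra_props(1)[OF subB] by auto
    next
      case False
      have inj: "inj_on (dim F) \<E>"
        using finite_subfield_eq_if_card_eq[OF finL] \<E> card[OF finE]
        by (intro inj_onI) metis
      have "card (\<Union>E\<in>\<E>. B <+>\<^bsub>R\<^esub> E) \<le> (\<Sum>E\<in>\<E>. card (B <+>\<^bsub>R\<^esub> E))"
        using card_UN_le[OF finite_\<E>] .
      also have "\<dots> \<le> (\<Sum>E\<in>\<E>. ?q ^ d * ?q ^ dim F E)"
      proof (rule sum_mono)
        fix E assume E: "E \<in> \<E>"
        have "card (B <+>\<^bsub>R\<^esub> E) = ?q ^ dim F (B <+>\<^bsub>R\<^esub> E)"
          using card[OF sum_space_dim(1)[OF F finB finE[OF E]]] .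
        also have "\<dots> \<le> ?q ^ (d + dim F E)"
          using sum_space_dim(2)[OF F finB finE[OF E]] dimB q
          unfolding over_def by (intro power_increasing) auto
        finally show "card (B <+>\<^bsub>R\<^esub> E) \<le> ?q ^ d * ?q ^ dim F E" by (simp add: power_add)
      qed
      also have "\<dots> = ?q ^ d * (\<Sum>j\<in>dim F ` \<E>. ?q ^ j)"
        by (simp add: sum.reindex[OF inj] sum_distrib_left)
      also have "\<dots> \<le> ?q ^ d * (\<Sum>j\<le>m. ?q ^ j)"
        using \<E> by (intro mult_le_mono2 sum_mono2) auto
      also have "\<dots> < ?q ^ d * ?q ^ Suc m"
        using sum_powers_less[OF q] q by simp
      also have "\<dots> = ?q ^ Suc (d + m)" by (simp add: power_add)
      also have "\<dots> \<le> ?q ^ dim F (carrier R)"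
        using small q by (intro power_increasing) auto
      finally have "card (\<Union>E\<in>\<E>. B <+>\<^bsub>R\<^esub> E) < card (carrier R)" using card_L by simp
      moreover have "(\<Union>E\<in>\<E>. B <+>\<^bsub>R\<^esub> E) \<subseteq> carrier R"
        using subalgebra_props(1)[OF sum(1)] by auto
      ultimately obtain x where x: "x \<in> carrier R" "x \<notin> (\<Union>E\<in>\<E>. B <+>\<^bsub>R\<^esub> E)"
        by (metis less_irrefl subsetI subset_antisym)
      moreover have "B \<subseteq> (\<Union>E\<in>\<E>. B <+>\<^bsub>R\<^esub> E)"
        using subalgebra_add_incl(1)[OF subB subE] False by blast
      ultimately have "x \<notin> B" "\<forall>E\<in>\<E>. x \<notin> B <+>\<^bsub>R\<^esub> E" by blast+
      then show ?thesis using x(1) by blast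
    qed
  qed
qed

section \<open>Primitive subspaces\<close>

lemma (in field) primitive_subspace_iff:
  assumes F: "subfield F R"
  shows "primitive_subspace R F B \<longleftrightarrow> subalgebra F B R \<and>
    (\<forall>E. subfield E R \<and> F \<subseteq> E \<and> E \<subset> carrier R \<longrightarrow> B \<inter> E \<subseteq> {\<zero>})" (is "?L \<longleftrightarrow> ?R")
proof
  assume ?L
  then have sub: "subalgebra F B R" and gen: "\<And>x. x \<in> B - {\<zero>} \<Longrightarrow> adjoin R F x = carrier R"
    by (auto simp: primitive_subspace_def)
  have "x = \<zero>" if E: "subfield E R" "F \<subseteq> E" "E \<subset> carrier R" and x: "x \<in> B" "x \<in> E" for E x
  proof (rule ccontr)
    assume "x \<noteq> \<zero>"
    then have "carrier R = generate_field R (insert x F)"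
      using gen x by (auto simp: adjoin_def)
    also have "\<dots> \<subseteq> E"
      using E x by (intro generate_field_min_subfield1) auto
    finally show False using E(3) by auto
  qed
  then show ?R using sub by auto
next
  assume R: ?R
  have "adjoin R F x = carrier R" if x: "x \<in> B" "x \<noteq> \<zero>" for x
  proof (rule ccontr)
    assume ne: "adjoin R F x \<noteq> carrier R"
    have in_carrier: "insert x F \<subseteq> carrier R"
      using subalgebra_props(1) subfieldE(3)[OF F] R x by auto
    have "insert x F \<subseteq> adjoin R F x"
      by (auto simp: adjoin_def intro: generate_field.incl)
    moreover have "subfield (adjoin R F x) R" "adjoin R F x \<subset> carrier R"
      using generate_field_is_subfield[OF in_carrier] generate_field_incl[OF in_carrier] ne
      unfolding adjoin_def by blast+
    ultimately show False using R x by blast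
  qed
  then show ?L using R by (auto simp: primitive_subspace_def)
qed

theorem theorem1p7:
  fixes L :: "('a, 'b) ring_scheme" and F :: "'a set"
  assumes "field L"
    and "subfield F L"
    and "ring.finite_dimension L F (carrier L)"
    and "simple_field_ext L F"
  shows "int (Max (primitive_dims L F)) =
    int (ring.dim L F (carrier L)) - int (max_proper_degree L F)"
proof -
  interpret field L by fact
  note F = assms(2) and fin = assms(3)
  let ?n = "dim F (carrier L)" and ?m = "max_proper_degree L F"
  define \<E> where "\<E> = {E. subfield E L \<and> F \<subseteq> E \<and> E \<subset> carrier L}"
  have degrees: "proper_intermediate_degrees L F = dim F ` \<E>"
    by (auto simp: proper_intermediate_degrees_def \<E>_def)
  have fin_degrees: "finite (dim F ` \<E>)"
    using finite_proper_intermediate_degrees[OF assms(1-3)] degrees by simp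
  have finite_sub: "finite_dimension F V" if "subalgebra F V L" for V
    using subalbegra_incl_imp_finite_dimension[OF F fin that subalgebra_props(1)[OF that]] .
  have subE: "subalgebra F E L" if "E \<in> \<E>" for E
    using that intermediate_ring_is_subalgebra[OF subfieldE(1)] by (auto simp: \<E>_def)
  have le_m: "dim F E \<le> ?m" if "E \<in> \<E>" for E
    using that fin_degrees by (auto simp: max_proper_degree_def degrees)

  have upper: "dim F B + ?m \<le> ?n" if B: "primitive_subspace L F B" for B
  proof -
    have subB: "subalgebra F B L" using B by (auto simp: primitive_subspace_def)
    show ?thesis
    proof (cases "\<E> = {}")
      case True
      then show ?thesis
        using subspace_dim_le[OF assms(1-3) subB] by (simp add: max_proper_degree_def degrees)
    next
      case False
      then have "?m \<in> dim F ` \<E>"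
        using Max_in[OF fin_degrees] by (simp add: max_proper_degree_def degrees)
      then obtain E where E: "E \<in> \<E>" "?m = dim F E" by auto
      have "B \<inter> E \<subseteq> {\<zero>\<^bsub>L\<^esub>}"
        using B E(1) primitive_subspace_iff[OF F] by (auto simp: \<E>_def)
      then have "B \<inter> E = {\<zero>\<^bsub>L\<^esub>}"
        using subalgebra_props(2)[OF subB] subalgebra_props(2)[OF subE[OF E(1)]] by auto
      then have sum: "dimension (dim F B + ?m) F (B <+>\<^bsub>L\<^esub> E)"
        using dimension_direct_sum_space[OF F finite_dimensionE[OF F finite_sub[OF subB]]
            finite_dimensionE[OF F finite_sub[OF subE[OF E(1)]]]] E(2) unfolding over_def by simp
      then have "subalgebra F (B <+>\<^bsub>L\<^esub> E) L"
        using finite_dimension_imp_subalgebra[OF F finite_dimensionI] by blast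
      then show ?thesis
        using subspace_dim_le[OF assms(1-3)] dimI[OF F sum] unfolding over_def by metis
    qed
  qed

  obtain \<theta> where \<theta>: "\<theta> \<in> carrier L" "generate_field L (insert \<theta> F) = carrier L"
    using assms(4) by (auto simp: simple_field_ext_def adjoin_def)
  have "\<exists>B. dimension (?n - ?m) F B \<and> (\<forall>E\<in>\<E>. B \<inter> E \<subseteq> {\<zero>\<^bsub>L\<^esub>})"
  proof (rule exists_complementary_subspace[OF F _ _ order_refl])
    show "finite_dimension F E" if "E \<in> \<E>" for E using finite_sub[OF subE[OF that]] .
    show "\<exists>x\<in>carrier L. x \<notin> B \<and> (\<forall>E\<in>\<E>. x \<notin> B <+>\<^bsub>L\<^esub> E)"
      if "dimension d F B" "d < ?n - ?m" for B d
      using exists_outside_sums_with_intermediate_fields[OF F fin \<theta> _ that(1), of \<E> ?m] that(2) le_m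
      by (auto simp: \<E>_def)
  qed
  then obtain B where B: "dimension (?n - ?m) F B" "\<forall>E\<in>\<E>. B \<inter> E \<subseteq> {\<zero>\<^bsub>L\<^esub>}" by auto
  then have prim: "primitive_subspace L F B"
    using primitive_subspace_iff[OF F] finite_dimension_imp_subalgebra[OF F finite_dimensionI]
    by (auto simp: \<E>_def)
  have dimB: "dim F B = ?n - ?m" using dimI[OF F B(1)] unfolding over_def .

  have "Max (primitive_dims L F) = ?n - ?m"
  proof (rule Max_eqI)
    show "finite (primitive_dims L F)" using finite_primitive_dims[OF assms(1-3)] .
    show "?n - ?m \<in> primitive_dims L F" using prim dimB by (force simp: primitive_dims_def)
    show "y \<le> ?n - ?m" if "y \<in> primitive_dims L F" for y
      using that upper by (force simp: primitive_dims_def)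
  qed
  moreover have "?m \<le> ?n" using upper[OF prim] by simp
  ultimately show ?thesis by simp
qed

end
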